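(* For every integer $n\ge 1$, the Möbius function of the Rees product of the cubical lattice with the chain is given by $$\mu(\operatorname{Rees}(\mathscr{C}_n,C_{n+1}))=(-1)^n\cdot n\cdot D_{n-1}^{\pm}.$$
   Context: $\mu(P)$ denotes the Möbius function value $\mu_P(\hat 0,\hat 1)$ of a finite poset $P$ with minimum $\hat 0$ and maximum $\hat 1$. $\mathscr{C}_n$ is the cubical lattice: the face lattice of the $n$-dimensional cube (including the empty face $\hat 0$), of rank $n+1$. $C_{n+1}$ is the chain on $n+1$ elements. Rees product: for posets $P,Q$ with rank functions $\rho$ (minimal elements having rank $0$), $P*Q$ is the set of pairs $(p,q)\in P\times Q$ with $\rho(p)\ge\rho(q)$, ordered by $(p,q)\le(p',q')$ iff $p\le_P p'$, $q\le_Q q'$ and $\rho(p')-\rho(p)\ge\rho(q')-\rho(q)$. For $P$ graded with minimum $\hat 0$ and maximum $\hat 1$, $\operatorname{Rees}(P,Q)=((P-\{\hat 0\})*Q)\cup\{\hat 0,\hat 1\}$, where a new minimum $\hat 0$ and a new maximum $\hat 1$ are adjoined, and where in $P-\{\hat 0\}$ the atoms of $P$ have rank $0$. The signed derangement number $D_m^{\pm}$ ($m\ge 0$) is the permanent of the $m\times m$ matrix with $1$'s on the diagonal and $2$'s everywhere else (with $D_0^{\pm}=1$); equivalently, the number of signed permutations $\pi=\pi_1\cdots\pi_m$ of $\{1,\dots,m\}$ with no index $i$ such that $\pi_i=i$. *)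

theory Defs
  imports "HOL-Analysis.Analysis" "HOL-Combinatorics.Permutations"
begin

text \<open>A poset is a relation r satisfying \<^term>\<open>Partial_order r\<close>; reflexivity makes
  \<^term>\<open>Field r\<close> its set of elements, and \<^term>\<open>(x, y) \<in> r\<close> means that x is below or equal to y.\<close>

definition poset_bot :: "'a rel \<Rightarrow> 'a" where
  "poset_bot r = (THE b. b \<in> Field r \<and> (\<forall>x\<in>Field r. (b, x) \<in> r))"

definition poset_top :: "'a rel \<Rightarrow> 'a" where
  "poset_top r = (THE t. t \<in> Field r \<and> (\<forall>x\<in>Field r. (x, t) \<in> r))"

lemma poset_bot_eqI:
  assumes "antisym r" "b \<in> Field r" "\<And>x. x \<in> Field r \<Longrightarrow> (b, x) \<in> r"
  shows "poset_bot r = b"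
  unfolding poset_bot_def using assms by (intro the_equality) (auto dest: antisymD)

lemma poset_top_eqI:
  assumes "antisym r" "t \<in> Field r" "\<And>x. x \<in> Field r \<Longrightarrow> (x, t) \<in> r"
  shows "poset_top r = t"
  unfolding poset_top_def using assms by (intro the_equality) (auto dest: antisymD)

text \<open>The two-argument Moebius function. The guard on r makes the recursion terminate; the value is
  0 if x is not below or equal to y, or if r is not a finite poset.\<close>

function moebius :: "'a rel \<Rightarrow> 'a \<Rightarrow> 'a \<Rightarrow> int" where
  "moebius r x y =
    (if finite r \<and> Partial_order r \<and> (x, y) \<in> r
     then if x = y then 1
          else - (\<Sum>z | (x, z) \<in> r \<and> (z, y) \<in> r \<and> z \<noteq> y. moebius r x z)
     else 0)"
  by pat_completeness auto
termination
proof (relation "Wellfounded.measure (\<lambda>(r, x, y). card {z. (z, y) \<in> r})", goal_cases)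
  case 1
  show ?case by simp
next
  case (2 r x y z)
  then have fin: "finite r" and po: "Partial_order r" and z: "(z, y) \<in> r" "z \<noteq> y" by auto
  have tr: "trans r" and an: "antisym r" and re: "refl_on (Field r) r"
    using po by (auto simp: order_on_defs)
  have "(y, y) \<in> r" using re z(1) by (auto simp: refl_on_def Field_def)
  then have "{w. (w, z) \<in> r} \<subset> {w. (w, y) \<in> r}"
    using z tr an by (auto dest: transD antisymD)
  moreover have "finite {w. (w, y) \<in> r}"
    using finite_subset[OF _ finite_imageI[OF fin, of fst], of "{w. (w, y) \<in> r}"] by force
  ultimately show ?case by (simp add: psubset_card_mono)
qed

declare moebius.simps [simp del]

definition poset_mu :: "'a rel \<Rightarrow> int" where
  "poset_mu r = moebius r (poset_bot r) (poset_top r)"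

definition covers :: "'a rel \<Rightarrow> 'a \<Rightarrow> 'a \<Rightarrow> bool" where
  "covers r x y \<longleftrightarrow>
     (x, y) \<in> r \<and> x \<noteq> y \<and> (\<forall>z. (x, z) \<in> r \<and> (z, y) \<in> r \<longrightarrow> z = x \<or> z = y)"

definition rank_function :: "'a rel \<Rightarrow> ('a \<Rightarrow> nat) \<Rightarrow> bool" where
  "rank_function r \<rho> \<longleftrightarrow>
     (\<forall>x\<in>Field r. (\<forall>y. (y, x) \<in> r \<longrightarrow> y = x) \<longrightarrow> \<rho> x = 0) \<and>
     (\<forall>x y. covers r x y \<longrightarrow> \<rho> y = \<rho> x + 1)"

text \<open>A rank function is determined only on \<^term>\<open>Field r\<close>, so the rank is chosen pointwise.\<close>

definition poset_rank :: "'a rel \<Rightarrow> 'a \<Rightarrow> nat" where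
  "poset_rank r x = (THE k. \<exists>\<rho>. rank_function r \<rho> \<and> \<rho> x = k)"

lemma rank_function_unique:
  assumes fin: "finite r" and po: "Partial_order r"
    and rho: "rank_function r \<rho>" and sigma: "rank_function r \<sigma>" and "x \<in> Field r"
  shows "\<rho> x = \<sigma> x"
proof -
  have tr: "trans r" and an: "antisym r" and re: "refl_on (Field r) r"
    using po by (auto simp: order_on_defs)
  have "acyclic (r - Id)"
    unfolding acyclic_def trancl_id[OF trans_diff_Id[OF tr an]] by simp
  then have wf: "wf (r - Id)" using fin by (simp add: finite_acyclic_wf)
  from \<open>x \<in> Field r\<close> show ?thesis
  proof (induction x rule: wf_induct_rule[OF wf])
    case (1 x)
    show ?case
    proof (cases "\<forall>y. (y, x) \<in> r \<longrightarrow> y = x")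
      case True
      then show ?thesis using rho sigma 1(2) by (auto simp: rank_function_def)
    next
      case False
      define S where "S = {y. (y, x) \<in> r \<and> y \<noteq> x}"
      have "wf ((r - Id)\<inverse>)"
        using fin \<open>acyclic (r - Id)\<close> by (intro finite_acyclic_wf_converse) auto
      moreover obtain s where "s \<in> S" using False by (auto simp: S_def)
      ultimately obtain y where y: "y \<in> S" "\<And>z. (z, y) \<in> (r - Id)\<inverse> \<Longrightarrow> z \<notin> S"
        by (rule wfE_min) blast
      have cov: "covers r y x" using y unfolding covers_def S_def by auto
      have "y \<in> Field r" "(y, x) \<in> r - Id" using y(1) by (auto simp: S_def Field_def)
      then have "\<rho> y = \<sigma> y" using 1(1) by blast
      then show ?thesis using cov rho sigma by (auto simp: rank_function_def)
    qed
  qed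
qed

lemma poset_rank_eq:
  assumes "finite r" "Partial_order r" "rank_function r \<rho>" "x \<in> Field r"
  shows "poset_rank r x = \<rho> x"
  unfolding poset_rank_def
  using assms rank_function_unique[OF assms(1,2)] by (intro the_equality) blast+

definition rees_product :: "'a rel \<Rightarrow> 'b rel \<Rightarrow> ('a \<times> 'b) rel" where
  "rees_product P Q =
     {((p, q), (p', q')).
        (p, p') \<in> P \<and> (q, q') \<in> Q \<and>
        poset_rank P p \<ge> poset_rank Q q \<and> poset_rank P p' \<ge> poset_rank Q q' \<and>
        int (poset_rank P p') - int (poset_rank P p)
          \<ge> int (poset_rank Q q') - int (poset_rank Q q)}"

datatype 'a bounded = Bot | Elt 'a | Top

definition adjoin_bounds :: "'a rel \<Rightarrow> 'a bounded rel" where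
  "adjoin_bounds r =
     map_prod Elt Elt ` r \<union> {Bot} \<times> ({Bot, Top} \<union> Elt ` Field r) \<union>
     ({Bot, Top} \<union> Elt ` Field r) \<times> {Top}"

definition Rees :: "'a rel \<Rightarrow> 'b rel \<Rightarrow> ('a \<times> 'b) bounded rel" where
  "Rees P Q = adjoin_bounds (rees_product (Restr P (Field P - {poset_bot P})) Q)"

definition face_lattice :: "'a::real_vector set \<Rightarrow> 'a set rel" where
  "face_lattice S = {(F, G). F face_of S \<and> G face_of S \<and> F \<subseteq> G}"

definition cubical_lattice :: "(real ^ 'n) set rel" where
  "cubical_lattice = face_lattice (cbox 0 1)"

definition chain_poset :: "nat \<Rightarrow> nat rel" where
  "chain_poset m = {(i, j). i \<le> j \<and> j < m}"

definition permanent :: "nat \<Rightarrow> (nat \<Rightarrow> nat \<Rightarrow> 'a::comm_semiring_1) \<Rightarrow> 'a" where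
  "permanent m A = (\<Sum>\<pi> | \<pi> permutes {..<m}. \<Prod>i<m. A i (\<pi> i))"

definition signed_derangement :: "nat \<Rightarrow> nat" where
  "signed_derangement m = permanent m (\<lambda>i j. if i = j then 1 else 2)"

end

theory Submission
  imports Defs
begin

text \<open>
  The Moebius function is computed downwards from the top element.  Write \<open>n\<close> for the dimension of
  the cube.  The faces above a \<open>k\<close>-dimensional face form a Boolean lattice of rank \<open>n - k\<close>, and above
  a face that is \<open>a\<close> dimensions larger the chain coordinate may increase by any of \<open>0, \<dots>, a\<close>.
  Hence the interval from \<open>(F, i)\<close> to the top depends only on the codimension \<open>r\<close> of \<open>F\<close>, and its
  Moebius value \<open>g r\<close> is determined by \<open>\<Sum>s\<le>r. (r choose s) * (r - s + 1) * g s = - 1\<close>.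
  In terms of exponential generating functions, \<open>G(x) (1 + x) e\<^sup>x = - e\<^sup>x\<close>, so \<open>G(x) = - 1 / (1 + x)\<close>
  and \<open>g r = - (- 1)^r * r!\<close>.

  There are \<open>2^r * (n choose r)\<close> faces of codimension \<open>r\<close>, each occurring with \<open>n - r + 1\<close> chain
  coordinates.  The value at the bottom element is therefore
  \<open>- 1 + (\<Sum>r\<le>n. (n choose r) * (n - r + 1) * (- 2)^r * r!)\<close>, whose generating function is
  \<open>- x e\<^sup>x / (1 + 2 x)\<close>.  Its coefficient of \<open>x\<^sup>n / n!\<close> is \<open>- n\<close> times the coefficient of
  \<open>x\<^sup>n\<^sup>-\<^sup>1 / (n - 1)!\<close> in \<open>e\<^sup>x / (1 + 2 x)\<close>, and the latter coefficients are the signed derangement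
  numbers with alternating signs.

  Both generating function computations are instances, at \<open>x = - 1\<close> and \<open>x = - 2\<close>, of the single
  identity \<open>sum_choose_fact_identity\<close>.  That a downward solution of the recursion is the Moebius
  function is \<open>moebius_eq_dual_weight\<close>; \<open>poset_mu_rees_chain\<close> specialises it to Rees products with
  a chain.  The combinatorics of the cube rests on \<open>face_of_cube_imp_cube_face\<close>: a nonempty face
  is given by the coordinates that are fixed and the values, 0 or 1, at which they are fixed.
\<close>

section \<open>Moebius functions from the dual recursion\<close>

lemma moebius_sum:
  assumes "finite r" "Partial_order r" "(x, y) \<in> r"
  shows "(\<Sum>z | (x, z) \<in> r \<and> (z, y) \<in> r. moebius r x z) = (if x = y then 1 else 0)"
proof -
  have an: "antisym r" and re: "refl_on (Field r) r"
    using assms(2) by (auto simp: order_on_defs)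
  have refl: "(x, x) \<in> r" "(y, y) \<in> r"
    using re assms(3) by (auto simp: refl_on_def Field_def)
  show ?thesis
  proof (cases "x = y")
    case True
    then have "{z. (x, z) \<in> r \<and> (z, y) \<in> r} = {x}"
      using an refl by (auto dest: antisymD)
    then show ?thesis using True assms by (simp add: moebius.simps[of r y y])
  next
    case False
    let ?I = "{z. (x, z) \<in> r \<and> (z, y) \<in> r}"
    have "?I \<subseteq> snd ` r" by force
    then have fin: "finite ?I" using assms(1) finite_subset by blast
    have "sum (moebius r x) ?I = moebius r x y + sum (moebius r x) (?I - {y})"
      using fin refl assms(3) by (intro sum.remove) auto
    also have "?I - {y} = {z. (x, z) \<in> r \<and> (z, y) \<in> r \<and> z \<noteq> y}" by auto
    finally show ?thesis using False assms by (subst (asm) moebius.simps[of r x y]) auto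
  qed
qed

text \<open>
  The recursion defining \<^const>\<open>moebius\<close> says that it is a one-sided inverse of the zeta function of
  the interval, and the hypothesis on \<open>\<nu>\<close> makes it an inverse on the other side.  The two agree by
  evaluating the sum of \<open>moebius r x z * \<nu> w\<close> over all \<open>z \<le> w\<close> in the interval in both orders.
\<close>

lemma moebius_eq_dual_weight:
  fixes \<nu> :: "'a \<Rightarrow> int"
  assumes fin: "finite r" and po: "Partial_order r" and xy: "(x, y) \<in> r"
    and \<nu>: "\<And>z. (x, z) \<in> r \<Longrightarrow> (z, y) \<in> r \<Longrightarrow>
      (\<Sum>w | (z, w) \<in> r \<and> (w, y) \<in> r. \<nu> w) = (if z = y then 1 else 0)"
  shows "moebius r x y = \<nu> x"
proof -
  have tr: "trans r" and re: "refl_on (Field r) r"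
    using po by (auto simp: order_on_defs)
  have refl: "(x, x) \<in> r" "(y, y) \<in> r"
    using re xy by (auto simp: refl_on_def Field_def)
  define I where "I = {z. (x, z) \<in> r \<and> (z, y) \<in> r}"
  have "I \<subseteq> snd ` r" unfolding I_def by force
  then have finI: "finite I" using fin finite_subset by blast
  have xyI: "x \<in> I" "y \<in> I" using refl xy by (auto simp: I_def)
  have up: "{w. (z, w) \<in> r \<and> (w, y) \<in> r} = {w \<in> I. (z, w) \<in> r}"
    and down: "{w. (x, w) \<in> r \<and> (w, z) \<in> r} = {w \<in> I. (w, z) \<in> r}" if "z \<in> I" for z
    using that tr by (auto simp: I_def dest: transD)
  have "moebius r x y = (\<Sum>z\<in>I. if z = y then moebius r x z else 0)"
    using finI xyI by simp
  also have "\<dots> = (\<Sum>z\<in>I. moebius r x z * (if z = y then 1 else 0))"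
    by (rule sum.cong) auto
  also have "\<dots> = (\<Sum>z\<in>I. moebius r x z * (\<Sum>w\<in>{w \<in> I. (z, w) \<in> r}. \<nu> w))"
  proof (rule sum.cong)
    fix z assume z: "z \<in> I"
    then have "(\<Sum>w\<in>{w \<in> I. (z, w) \<in> r}. \<nu> w) = (if z = y then 1 else 0)"
      unfolding up[OF z, symmetric] by (intro \<nu>) (auto simp: I_def)
    then show "moebius r x z * (if z = y then 1 else 0) =
      moebius r x z * (\<Sum>w\<in>{w \<in> I. (z, w) \<in> r}. \<nu> w)" by simp
  qed simp
  also have "\<dots> = (\<Sum>z\<in>I. \<Sum>w\<in>I. if (z, w) \<in> r then moebius r x z * \<nu> w else 0)"
    using finI by (auto simp: sum_distrib_left sum.inter_filter intro!: sum.cong)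
  also have "\<dots> = (\<Sum>w\<in>I. \<Sum>z\<in>I. if (z, w) \<in> r then moebius r x z * \<nu> w else 0)"
    by (rule sum.swap)
  also have "\<dots> = (\<Sum>w\<in>I. (\<Sum>z\<in>{z \<in> I. (z, w) \<in> r}. moebius r x z) * \<nu> w)"
    using finI by (auto simp: sum_distrib_right sum.inter_filter intro!: sum.cong)
  also have "\<dots> = (\<Sum>w\<in>I. (if x = w then 1 else 0) * \<nu> w)"
  proof (rule sum.cong)
    fix w assume w: "w \<in> I"
    then have "(\<Sum>z\<in>{z \<in> I. (z, w) \<in> r}. moebius r x z) = (if x = w then 1 else 0)"
      unfolding down[OF w, symmetric] by (intro moebius_sum fin po) (auto simp: I_def)
    then show "(\<Sum>z\<in>{z \<in> I. (z, w) \<in> r}. moebius r x z) * \<nu> w =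
      (if x = w then 1 else 0) * \<nu> w" by simp
  qed simp
  also have "\<dots> = (\<Sum>w\<in>I. if x = w then \<nu> w else 0)"
    by (rule sum.cong) auto
  also have "\<dots> = \<nu> x" using finI xyI by simp
  finally show ?thesis .
qed

section \<open>Adjoining bounds\<close>

lemma Partial_order_adjoin_bounds:
  assumes "Partial_order r"
  shows "Partial_order (adjoin_bounds r)"
proof -
  have r: "trans r" "antisym r" "refl_on (Field r) r"
    using assms by (auto simp: order_on_defs)
  have F: "Field (adjoin_bounds r) = {Bot, Top} \<union> Elt ` Field r"
    unfolding adjoin_bounds_def Field_def by force
  have "refl_on (Field (adjoin_bounds r)) (adjoin_bounds r)"
    unfolding F using r(3) by (force simp: adjoin_bounds_def refl_on_def)
  moreover have "trans (adjoin_bounds r)"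
    by (rule transI) (use r(1) in \<open>auto simp: adjoin_bounds_def Field_def dest: transD\<close>)
  moreover have "antisym (adjoin_bounds r)"
    by (rule antisymI) (use r(2) in \<open>auto simp: adjoin_bounds_def dest: antisymD\<close>)
  ultimately show ?thesis
    by (auto simp: order_on_defs FieldI1 FieldI2)
qed

lemma poset_bot_adjoin_bounds:
  assumes "Partial_order r" shows "poset_bot (adjoin_bounds r) = Bot"
  using Partial_order_adjoin_bounds[OF assms]
  by (intro poset_bot_eqI) (auto simp: order_on_defs adjoin_bounds_def Field_def)

lemma poset_top_adjoin_bounds:
  assumes "Partial_order r" shows "poset_top (adjoin_bounds r) = Top"
  using Partial_order_adjoin_bounds[OF assms]
  by (intro poset_top_eqI) (auto simp: order_on_defs adjoin_bounds_def Field_def)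

lemma adjoin_bounds_iff [simp]:
  "(Bot, Bot) \<in> adjoin_bounds r"
  "(Bot, Elt a) \<in> adjoin_bounds r \<longleftrightarrow> a \<in> Field r"
  "(x, Top) \<in> adjoin_bounds r \<longleftrightarrow> x \<in> {Bot, Top} \<union> Elt ` Field r"
  "(Bot, Top) \<in> adjoin_bounds r"
  "(Elt a, Elt b) \<in> adjoin_bounds r \<longleftrightarrow> (a, b) \<in> r"
  "(Elt a, Bot) \<notin> adjoin_bounds r"
  "(Top, Bot) \<notin> adjoin_bounds r"
  "(Top, Elt a) \<notin> adjoin_bounds r"
  by (auto simp: adjoin_bounds_def)

text \<open>
  Here \<open>f a\<close> is the Moebius value of the interval from \<open>a\<close> to the new top element, whose own weight
  is 1; the hypothesis is the recursion that determines these values.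
\<close>

lemma poset_mu_adjoin_bounds:
  fixes f :: "'a \<Rightarrow> int"
  assumes fin: "finite r" and po: "Partial_order r"
    and f: "\<And>a. a \<in> Field r \<Longrightarrow> (\<Sum>b | (a, b) \<in> r. f b) = - 1"
  shows "poset_mu (adjoin_bounds r) = - 1 - (\<Sum>a\<in>Field r. f a)"
proof -
  let ?R = "adjoin_bounds r"
  define \<nu> where "\<nu> w = (case w of Bot \<Rightarrow> - 1 - sum f (Field r) | Elt a \<Rightarrow> f a | Top \<Rightarrow> 1)" for w
  have \<nu>_simps: "\<nu> Bot = - 1 - sum f (Field r)" "\<nu> (Elt a) = f a" "\<nu> Top = 1" for a
    by (simp_all add: \<nu>_def)
  have finF: "finite (Field r)" using fin by (rule finite_Field)
  have finR: "finite ?R" unfolding adjoin_bounds_def using fin finF by simp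
  have sumElt: "(\<Sum>w\<in>Elt ` A. \<nu> w) = sum f A" for A
    by (subst sum.reindex) (auto simp: inj_on_def \<nu>_simps)
  have "moebius ?R Bot Top = \<nu> Bot"
  proof (rule moebius_eq_dual_weight[OF finR Partial_order_adjoin_bounds[OF po]])
    fix z assume z: "(z, Top) \<in> ?R"
    show "(\<Sum>w | (z, w) \<in> ?R \<and> (w, Top) \<in> ?R. \<nu> w) = (if z = Top then 1 else 0)"
    proof (cases z)
      case Bot
      have "{w. (z, w) \<in> ?R \<and> (w, Top) \<in> ?R} = insert Bot (insert Top (Elt ` Field r))"
        using Bot by auto
      then show ?thesis using Bot finF by (simp add: image_iff sumElt \<nu>_simps)
    next
      case (Elt a)
      then have a: "a \<in> Field r" using z by auto
      have "{w. (z, w) \<in> ?R \<and> (w, Top) \<in> ?R} = insert Top (Elt ` {b. (a, b) \<in> r})"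
      proof (rule set_eqI)
        fix w show "w \<in> {w. (z, w) \<in> ?R \<and> (w, Top) \<in> ?R} \<longleftrightarrow> w \<in> insert Top (Elt ` {b. (a, b) \<in> r})"
          using Elt a by (cases w) (auto simp: FieldI2)
      qed
      moreover have "finite {b. (a, b) \<in> r}"
        by (rule finite_subset[OF _ finF]) (auto simp: FieldI2)
      ultimately show ?thesis using Elt f[OF a] by (simp add: image_iff sumElt \<nu>_simps)
    next
      case Top
      have "{w. (z, w) \<in> ?R \<and> (w, Top) \<in> ?R} = {Top}"
      proof (rule set_eqI)
        fix w show "w \<in> {w. (z, w) \<in> ?R \<and> (w, Top) \<in> ?R} \<longleftrightarrow> w \<in> {Top}"
          using Top by (cases w) auto
      qed
      then show ?thesis using Top by (simp add: \<nu>_simps)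
    qed
  qed simp
  then show ?thesis
    by (simp add: poset_mu_def poset_bot_adjoin_bounds[OF po] poset_top_adjoin_bounds[OF po] \<nu>_simps)
qed

section \<open>Rees products with a chain\<close>

lemma Field_chain_poset: "Field (chain_poset m) = {..<m}"
  by (auto simp: chain_poset_def Field_def)

lemma Partial_order_chain_poset: "Partial_order (chain_poset m)"
  unfolding order_on_defs Field_chain_poset
  by (auto simp: chain_poset_def refl_on_def trans_def antisym_def)

lemma poset_rank_chain_poset:
  assumes "i < m" shows "poset_rank (chain_poset m) i = i"
proof (rule poset_rank_eq)
  show "finite (chain_poset m)"
    by (rule finite_subset[of _ "{..<m} \<times> {..<m}"]) (auto simp: chain_poset_def)
  have "y = x + 1" if "covers (chain_poset m) x y" for x y
  proof -
    have "x < y" "y < m" using that by (auto simp: covers_def chain_poset_def)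
    then have "(x, x + 1) \<in> chain_poset m" "(x + 1, y) \<in> chain_poset m"
      by (auto simp: chain_poset_def)
    with that have "x + 1 = x \<or> x + 1 = y" unfolding covers_def by blast
    then show ?thesis by simp
  qed
  moreover have "x = 0" if "x \<in> Field (chain_poset m)" "\<forall>y. (y, x) \<in> chain_poset m \<longrightarrow> y = x" for x
    using that(2)[rule_format, of 0] that(1) unfolding Field_chain_poset by (auto simp: chain_poset_def)
  ultimately show "rank_function (chain_poset m) (\<lambda>i. i)"
    by (auto simp: rank_function_def)
  show "i \<in> Field (chain_poset m)" using assms by (simp add: Field_chain_poset)
qed (rule Partial_order_chain_poset)

text \<open>
  All bounds on the chain coordinates implicit in the Rees product collapse: since the rank of \<open>q\<close>
  is less than \<open>m\<close>, a chain coordinate can grow to the full extent of the rank difference.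
\<close>

lemma rees_product_chain_iff:
  assumes mono: "\<And>p q. (p, q) \<in> P \<Longrightarrow> poset_rank P p \<le> poset_rank P q"
    and len: "\<And>p. p \<in> Field P \<Longrightarrow> poset_rank P p < m"
  shows "((p, i), (q, j)) \<in> rees_product P (chain_poset m) \<longleftrightarrow>
    (p, q) \<in> P \<and> i \<le> poset_rank P p \<and> i \<le> j \<and> j \<le> i + (poset_rank P q - poset_rank P p)"
    (is "?L \<longleftrightarrow> ?R")
proof
  assume ?L
  then have "i \<le> j" "j < m" by (auto simp: rees_product_def chain_poset_def)
  then show ?R using \<open>?L\<close> poset_rank_chain_poset[of i m] poset_rank_chain_poset[of j m]
    by (auto simp: rees_product_def)
next
  assume ?R
  then have "(p, q) \<in> P" by simp
  from mono[OF this] len[OF FieldI2[OF this]] \<open>?R\<close>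
  have "j < m" "i \<le> j" by auto
  then show ?L using mono[OF \<open>(p, q) \<in> P\<close>] \<open>?R\<close>
      poset_rank_chain_poset[of i m] poset_rank_chain_poset[of j m]
    by (auto simp: rees_product_def chain_poset_def)
qed

text \<open>
  The weight of a pair is taken to depend on its first component only, which is consistent because
  the number of chain coordinates \<open>j\<close> available to \<open>q\<close> above \<open>(p, i)\<close>, namely the rank difference
  plus one, does not depend on \<open>i\<close>.
\<close>

lemma poset_mu_rees_chain:
  fixes f :: "'a \<Rightarrow> int"
  assumes fin: "finite P" and po: "Partial_order P"
    and mono: "\<And>p q. (p, q) \<in> P \<Longrightarrow> poset_rank P p \<le> poset_rank P q"
    and len: "\<And>p. p \<in> Field P \<Longrightarrow> poset_rank P p < m"
    and f: "\<And>p. p \<in> Field P \<Longrightarrow>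
      (\<Sum>q | (p, q) \<in> P. int (poset_rank P q - poset_rank P p + 1) * f q) = - 1"
  shows "poset_mu (adjoin_bounds (rees_product P (chain_poset m))) =
    - 1 - (\<Sum>p\<in>Field P. int (poset_rank P p + 1) * f p)"
proof -
  let ?\<rho> = "poset_rank P"
  let ?R = "rees_product P (chain_poset m)"
  note iff = rees_product_chain_iff[where P=P and m=m, OF mono len]
  have P: "trans P" "antisym P" "refl_on (Field P) P"
    using po by (auto simp: order_on_defs)
  have finF: "finite (Field P)" using fin by (rule finite_Field)
  have fin_up: "finite {q. (p, q) \<in> P}" for p
    by (rule finite_subset[OF _ finF]) (auto simp: FieldI2)
  have F: "Field ?R = (SIGMA p:Field P. {..?\<rho> p})"
  proof (rule set_eqI)
    fix x :: "'a \<times> nat"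
    obtain p i where x: "x = (p, i)" by force
    have "(p, i) \<in> Field ?R" if "p \<in> Field P" "i \<le> ?\<rho> p"
      by (rule FieldI1[of _ "(p, i)"]) (use that P(3) in \<open>auto simp: iff refl_on_def\<close>)
    moreover have "p \<in> Field P \<and> i \<le> ?\<rho> p" if "(p, i) \<in> Field ?R"
    proof -
      from that obtain q j where "((p, i), (q, j)) \<in> ?R \<or> ((q, j), (p, i)) \<in> ?R"
        unfolding Field_def by auto
      then show ?thesis
        using mono by (fastforce simp: iff FieldI1 FieldI2)
    qed
    ultimately show "x \<in> Field ?R \<longleftrightarrow> x \<in> (SIGMA p:Field P. {..?\<rho> p})" using x by auto
  qed
  have "finite (Field ?R)" unfolding F using finF by simp
  then have finR: "finite ?R"
    by (intro finite_subset[of ?R "Field ?R \<times> Field ?R"]) (auto simp: FieldI1 FieldI2)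
  have "refl_on (Field ?R) ?R"
    unfolding F using P(3) by (auto simp: refl_on_def iff)
  moreover have "antisym ?R"
    using P(2) by (auto simp: antisym_def iff)
  moreover have "trans ?R"
  proof (rule transI)
    fix x y z assume "(x, y) \<in> ?R" "(y, z) \<in> ?R"
    moreover obtain p i q j u k where "x = (p, i)" "y = (q, j)" "z = (u, k)" by (metis surj_pair)
    ultimately show "(x, z) \<in> ?R"
      using mono[of p q] mono[of q u] transD[OF P(1), of p q u] by (auto simp: iff)
  qed
  ultimately have poR: "Partial_order ?R" by (auto simp: order_on_defs FieldI1 FieldI2)
  have "poset_mu (adjoin_bounds ?R) = - 1 - (\<Sum>x\<in>Field ?R. f (fst x))"
  proof (rule poset_mu_adjoin_bounds[OF finR poR])
    fix x assume "x \<in> Field ?R"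
    then obtain p i where x: "x = (p, i)" and p: "p \<in> Field P" "i \<le> ?\<rho> p"
      unfolding F by auto
    have "{y. (x, y) \<in> ?R} = (SIGMA q:{q. (p, q) \<in> P}. {i..i + (?\<rho> q - ?\<rho> p)})"
      using p unfolding x by (auto simp: iff)
    then have "(\<Sum>y | (x, y) \<in> ?R. f (fst y)) =
        (\<Sum>q | (p, q) \<in> P. \<Sum>j\<in>{i..i + (?\<rho> q - ?\<rho> p)}. f q)"
      using fin_up by (simp add: sum.Sigma split_beta del: sum_constant)
    also have "\<dots> = (\<Sum>q | (p, q) \<in> P. int (?\<rho> q - ?\<rho> p + 1) * f q)"
      by (rule sum.cong) auto
    finally show "(\<Sum>y | (x, y) \<in> ?R. f (fst y)) = - 1" using f[OF p(1)] by simp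
  qed
  also have "(\<Sum>x\<in>Field ?R. f (fst x)) = (\<Sum>p\<in>Field P. \<Sum>i\<in>{..?\<rho> p}. f p)"
    unfolding F using finF by (simp add: sum.Sigma split_beta del: sum_constant)
  finally show ?thesis by simp
qed

section \<open>Binomial sums\<close>

text \<open>
  Split \<open>n - s + 1\<close> into \<open>n - s\<close> and \<open>1\<close>.  By absorption, \<open>(n choose s) * (n - s)\<close> equals
  \<open>n * (n - 1 choose s)\<close>, and the \<open>s\<close>-th term of the rest is \<open>n * x\<close> times the previous term of the
  sum for \<open>n - 1\<close>.  At \<open>x = - 1\<close> the right-hand side is 1, which solves the recursion for the
  intervals below the top; at \<open>x = - 2\<close> it gives the final value.
\<close>

lemma sum_choose_fact_identity:
  fixes x :: int
  assumes "n > 0"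
  shows "(\<Sum>s\<le>n. int (n choose s) * (int (n - s + 1) * (fact s * x ^ s))) =
    1 + int n * (1 + x) * (\<Sum>s<n. int (n - 1 choose s) * (fact s * x ^ s))"
proof -
  obtain k where n: "n = Suc k" using assms by (cases n) auto
  let ?E = "\<Sum>s\<le>k. int (k choose s) * (fact s * x ^ s)"
  have 1: "int (n choose s) * int (n - s) = int n * int (k choose s)" for s
    using binomial_absorb_comp[of n s] unfolding n
    by (metis diff_Suc_1 mult.commute of_nat_mult)
  have "(\<Sum>s\<le>n. int (n choose s) * (int (n - s + 1) * (fact s * x ^ s))) =
      (\<Sum>s\<le>n. int (n choose s) * int (n - s) * (fact s * x ^ s)) +
      (\<Sum>s\<le>n. int (n choose s) * (fact s * x ^ s))"
    by (simp add: sum.distrib[symmetric] algebra_simps)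
  also have "(\<Sum>s\<le>n. int (n choose s) * int (n - s) * (fact s * x ^ s)) = int n * ?E"
    unfolding 1 unfolding n by (simp add: sum_distrib_left mult.assoc)
  also have "(\<Sum>s\<le>n. int (n choose s) * (fact s * x ^ s)) =
      1 + (\<Sum>s\<le>k. int (n choose Suc s) * (fact (Suc s) * x ^ Suc s))"
    unfolding n by (subst sum.atMost_Suc_shift) simp
  also have "(\<Sum>s\<le>k. int (n choose Suc s) * (fact (Suc s) * x ^ Suc s)) =
      (\<Sum>s\<le>k. int n * x * (int (k choose s) * (fact s * x ^ s)))"
  proof (rule sum.cong[OF refl])
    fix s
    have "int (Suc s) * int (n choose Suc s) = int n * int (k choose s)"
      unfolding n by (metis Suc_times_binomial of_nat_mult)
    then have "int (n choose Suc s) * (int (Suc s) * (fact s * (x * x ^ s))) =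
        (int n * int (k choose s)) * (fact s * (x * x ^ s))"
      by (metis mult.assoc mult.commute)
    then show "int (n choose Suc s) * (fact (Suc s) * x ^ Suc s) =
        int n * x * (int (k choose s) * (fact s * x ^ s))"
      by (simp add: mult_ac)
  qed
  also have "\<dots> = int n * x * ?E"
    by (rule sum_distrib_left[symmetric])
  finally show ?thesis unfolding n lessThan_Suc_atMost diff_Suc_1
    by (simp only: algebra_simps)
qed

lemma sum_Pow_card:
  fixes g :: "nat \<Rightarrow> int"
  assumes "finite S"
  shows "(\<Sum>A\<in>Pow S. g (card A)) = (\<Sum>s\<le>card S. int (card S choose s) * g s)"
proof -
  have "(\<Sum>A\<in>Pow S. g (card A)) = (\<Sum>s\<le>card S. \<Sum>A\<in>{A \<in> Pow S. card A = s}. g (card A))"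
    using assms by (intro sum.group[symmetric]) (auto intro: card_mono)
  also have "\<dots> = (\<Sum>s\<le>card S. int (card S choose s) * g s)"
    by (rule sum.cong) (auto simp: n_subsets[OF assms])
  finally show ?thesis .
qed

section \<open>Signed derangement numbers\<close>

text \<open>
  Expand the permanent of \<open>2 J - I\<close>, with \<open>J\<close> the all-ones matrix: choosing the summand \<open>2 J\<close> in
  the rows \<open>S\<close> and \<open>- I\<close> in the others leaves exactly the permutations that fix every point outside
  \<open>S\<close>, of which there are \<open>(card S)!\<close>.
\<close>

lemma signed_derangement_eq:
  "int (signed_derangement m) = (- 1) ^ m * (\<Sum>r\<le>m. int (m choose r) * (fact r * (- 2) ^ r))"
proof -
  let ?N = "{..<m}"
  have 1: "(\<Sum>\<pi> | \<pi> permutes ?N. \<Prod>i\<in>?N - S. if i = \<pi> i then - 1 else 0) =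
      (- 1) ^ (m - card S) * (fact (card S) :: int)" if S: "S \<subseteq> ?N" for S
  proof -
    have fin: "finite S" using S finite_subset by blast
    have "(\<Sum>\<pi> | \<pi> permutes ?N. \<Prod>i\<in>?N - S. if i = \<pi> i then - 1 else 0) =
        (\<Sum>\<pi> | \<pi> permutes ?N. if \<pi> permutes S then (- 1) ^ (m - card S) else (0::int))"
    proof (rule sum.cong[OF refl])
      fix \<pi> assume "\<pi> \<in> {\<pi>. \<pi> permutes ?N}"
      then have \<pi>: "\<pi> permutes ?N" by simp
      show "(\<Prod>i\<in>?N - S. if i = \<pi> i then - 1 else 0) =
        (if \<pi> permutes S then (- 1) ^ (m - card S) else (0::int))"
      proof (cases "\<forall>i\<in>?N - S. \<pi> i = i")
        case True
        then have "\<pi> permutes S" using permutes_superset[OF \<pi>] by auto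
        moreover have "(\<Prod>i\<in>?N - S. if i = \<pi> i then - 1 else (0::int)) = (\<Prod>i\<in>?N - S. - 1)"
          by (rule prod.cong) (use True in auto)
        ultimately show ?thesis using S fin by (simp add: card_Diff_subset)
      next
        case False
        then obtain i where i: "i \<in> ?N - S" "\<pi> i \<noteq> i" by blast
        then have "\<not> \<pi> permutes S" by (auto simp: permutes_def)
        moreover have "(\<Prod>i\<in>?N - S. if i = \<pi> i then - 1 else (0::int)) = 0"
          using i by (intro prod_zero bexI[of _ i]) auto
        ultimately show ?thesis by simp
      qed
    qed
    also have "\<dots> = (\<Sum>\<pi> | \<pi> permutes S. (- 1) ^ (m - card S))"
      by (rule sum.mono_neutral_cong_right)
        (use S in \<open>auto simp: finite_permutations intro: permutes_subset\<close>)
    also have "\<dots> = (- 1) ^ (m - card S) * fact (card S)"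
      using card_permutations[OF refl fin] by simp
    finally show ?thesis .
  qed
  have "int (signed_derangement m) =
      (\<Sum>\<pi> | \<pi> permutes ?N. \<Prod>i\<in>?N. 2 + (if i = \<pi> i then - 1 else 0))"
    unfolding signed_derangement_def permanent_def of_nat_sum of_nat_prod
    by (intro sum.cong prod.cong) auto
  also have "\<dots> = (\<Sum>\<pi> | \<pi> permutes ?N. \<Sum>S\<in>Pow ?N.
      (\<Prod>i\<in>S. 2) * (\<Prod>i\<in>?N - S. if i = \<pi> i then - 1 else 0))"
    by (simp add: prod_add)
  also have "\<dots> = (\<Sum>S\<in>Pow ?N. (\<Prod>i\<in>S. 2) *
      (\<Sum>\<pi> | \<pi> permutes ?N. \<Prod>i\<in>?N - S. if i = \<pi> i then - 1 else 0))"
    by (subst sum.swap) (simp add: sum_distrib_left)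
  also have "\<dots> = (\<Sum>S\<in>Pow ?N. (- 1) ^ m * (fact (card S) * (- 2) ^ card S))"
  proof (rule sum.cong[OF refl])
    fix S assume S: "S \<in> Pow ?N"
    then have "card S \<le> m" using card_mono[of ?N S] by simp
    then have "(- 1 :: int) ^ m = (- 1) ^ (m - card S) * (- 1) ^ card S"
      by (simp flip: power_add)
    moreover have "(- 2 :: int) ^ card S = (- 1) ^ card S * 2 ^ card S"
      by (simp flip: power_mult_distrib)
    moreover have "(- 1 :: int) ^ card S * (- 1) ^ card S = 1"
      by (simp flip: power_mult_distrib)
    ultimately show "(\<Prod>i\<in>S. 2) *
        (\<Sum>\<pi> | \<pi> permutes ?N. \<Prod>i\<in>?N - S. if i = \<pi> i then - 1 else 0) =
      (- 1 :: int) ^ m * (fact (card S) * (- 2) ^ card S)"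
      using 1[of S] S by (simp add: algebra_simps)
  qed
  also have "\<dots> = (- 1) ^ m * (\<Sum>r\<le>m. int (m choose r) * (fact r * (- 2) ^ r))"
    by (simp add: sum_distrib_left[symmetric] sum_Pow_card[of ?N "\<lambda>r. fact r * (- 2) ^ r"])
  finally show ?thesis .
qed

section \<open>Nonempty faces of the cube\<close>

text \<open>
  The set \<open>S\<close> consists of the fixed coordinates, and \<open>T \<subseteq> S\<close> of those fixed at 1.  Without
  \<open>T \<subseteq> S\<close> the representation would not be unique.
\<close>

definition cube_face :: "'n::finite set \<Rightarrow> 'n set \<Rightarrow> (real ^ 'n) set" where
  "cube_face S T = {x \<in> cbox 0 1. \<forall>i\<in>S. x $ i = of_bool (i \<in> T)}"

text \<open>
  This point shows that a face determines its parameters: its coordinates are \<open>1 / 2\<close> outside \<open>S\<close>.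
\<close>

definition cube_face_center :: "'n::finite set \<Rightarrow> 'n set \<Rightarrow> real ^ 'n" where
  "cube_face_center S T = (\<chi> i. if i \<in> S then of_bool (i \<in> T) else 1 / 2)"

lemma mem_unit_cube: "x \<in> cbox 0 (1 :: real ^ 'n::finite) \<longleftrightarrow> (\<forall>i. 0 \<le> x $ i \<and> x $ i \<le> 1)"
  by (simp add: mem_box_cart)

lemma cube_face_center_mem: "cube_face_center S T \<in> cube_face S T"
  by (auto simp: cube_face_def cube_face_center_def mem_unit_cube)

lemma cube_face_subset_iff:
  assumes "T \<subseteq> S" "T' \<subseteq> S'"
  shows "cube_face S T \<subseteq> cube_face S' T' \<longleftrightarrow> S' \<subseteq> S \<and> T' = T \<inter> S'"
proof
  assume "cube_face S T \<subseteq> cube_face S' T'"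
  then have "cube_face_center S T \<in> cube_face S' T'" using cube_face_center_mem by blast
  then have *: "(if i \<in> S then of_bool (i \<in> T) else 1 / 2) = (of_bool (i \<in> T') :: real)" if "i \<in> S'" for i
    using that by (auto simp: cube_face_def cube_face_center_def)
  have "i \<in> S \<and> (i \<in> T \<longleftrightarrow> i \<in> T')" if "i \<in> S'" for i
    using *[OF that] by (auto split: if_splits simp: of_bool_def)
  then show "S' \<subseteq> S \<and> T' = T \<inter> S'" using assms by blast
next
  assume "S' \<subseteq> S \<and> T' = T \<inter> S'"
  then show "cube_face S T \<subseteq> cube_face S' T'" by (auto simp: cube_face_def)
qed

text \<open>
  If a coordinate of an interior point of a segment in the cube attains an extreme value 0 or 1, so
  do the corresponding coordinates of both endpoints.
\<close>

lemma cube_face_face_of: "cube_face S T face_of cbox 0 1"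
  unfolding face_of_def
proof (intro conjI ballI impI)
  show "cube_face S T \<subseteq> cbox 0 1" by (auto simp: cube_face_def)
  have "convex (cbox 0 1 \<inter> (\<Inter>i\<in>S. {x :: real ^ 'a. x $ i = of_bool (i \<in> T)}))"
    by (intro convex_Int convex_INT convex_box) (auto simp: convex_def algebra_simps)
  also have "cbox 0 1 \<inter> (\<Inter>i\<in>S. {x :: real ^ 'a. x $ i = of_bool (i \<in> T)}) = cube_face S T"
    by (auto simp: cube_face_def)
  finally show "convex (cube_face S T)" .
  fix a b x :: "real ^ 'a"
  assume a: "a \<in> cbox 0 1" and b: "b \<in> cbox 0 1" and x: "x \<in> cube_face S T"
    and "x \<in> open_segment a b"
  then obtain u where u: "0 < u" "u < 1" and xu: "x = (1 - u) *\<^sub>R a + u *\<^sub>R b"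
    by (auto simp: in_segment)
  have "a $ i = of_bool (i \<in> T) \<and> b $ i = of_bool (i \<in> T)" if "i \<in> S" for i
  proof -
    have xi: "(1 - u) * a $ i + u * b $ i = of_bool (i \<in> T)"
      using x that by (simp add: cube_face_def xu)
    have ab: "0 \<le> a $ i" "a $ i \<le> 1" "0 \<le> b $ i" "b $ i \<le> 1"
      using a b by (auto simp: mem_unit_cube)
    show ?thesis
    proof (cases "i \<in> T")
      case True
      have "(1 - u) * (1 - a $ i) + u * (1 - b $ i) = 0"
        using xi True by (simp add: algebra_simps)
      moreover have "(1 - u) * (1 - a $ i) \<ge> 0" "u * (1 - b $ i) \<ge> 0" using u ab by auto
      ultimately have "(1 - u) * (1 - a $ i) = 0" "u * (1 - b $ i) = 0" by linarith+
      then show ?thesis using u True by simp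
    next
      case False
      moreover have "(1 - u) * a $ i \<ge> 0" "u * b $ i \<ge> 0" using u ab by auto
      ultimately have "(1 - u) * a $ i = 0" "u * b $ i = 0" using xi by (auto simp: add_nonneg_eq_0_iff)
      then show ?thesis using u False by simp
    qed
  qed
  with a b show "a \<in> cube_face S T" "b \<in> cube_face S T" by (auto simp: cube_face_def)
qed

text \<open>
  Choose a point \<open>p\<close> of \<open>F\<close> with as few coordinates in \<open>{0, 1}\<close> as possible.  The midpoint of \<open>p\<close>
  and any \<open>x \<in> F\<close> has a coordinate in \<open>{0, 1}\<close> only where \<open>p\<close> and \<open>x\<close> agree, so minimality forces
  \<open>x\<close> to share all such coordinates of \<open>p\<close>; thus \<open>F\<close> is contained in the cube face fixing them.
  Conversely, \<open>p\<close> is in the relative interior of that cube face: a segment from any of its points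
  to \<open>p\<close> can be prolonged beyond \<open>p\<close> inside the cube, so the face property puts the point into \<open>F\<close>.
\<close>

lemma face_of_cube_imp_cube_face:
  fixes F :: "(real ^ 'n::finite) set"
  assumes F: "F face_of cbox 0 1" and ne: "F \<noteq> {}"
  obtains S T where "T \<subseteq> S" "F = cube_face S T"
proof -
  define Z where "Z x = {i. x $ i = 0 \<or> x $ i = 1}" for x :: "real ^ 'n"
  have sub: "F \<subseteq> cbox 0 1" and conv: "convex F" using F by (auto simp: face_of_def)
  obtain p where p: "p \<in> F" and pmin: "\<And>x. x \<in> F \<Longrightarrow> card (Z p) \<le> card (Z x)"
    using ne ex_has_least_nat[of "\<lambda>x. x \<in> F" _ "\<lambda>x. card (Z x)"] by blast
  have pc: "0 \<le> p $ i" "p $ i \<le> 1" for i using p sub by (auto simp: mem_unit_cube)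
  define T where "T = {i. p $ i = 1}"
  have "F \<subseteq> cube_face (Z p) T"
  proof
    fix x assume x: "x \<in> F"
    then have xc: "0 \<le> x $ i" "x $ i \<le> 1" for i using sub by (auto simp: mem_unit_cube)
    define y where "y = (1 / 2) *\<^sub>R p + (1 / 2) *\<^sub>R x"
    have y: "y \<in> F" unfolding y_def using conv p x by (intro convexD) auto
    have yi: "y $ i = (p $ i + x $ i) / 2" for i by (simp add: y_def field_simps)
    have *: "p $ i = y $ i \<and> x $ i = y $ i" if "i \<in> Z y" for i
      using that pc[of i] xc[of i] by (auto simp: Z_def yi)
    then have "Z y \<subseteq> Z p" by (auto simp: Z_def)
    with pmin[OF y] have "Z y = Z p" by (simp add: card_seteq)
    then have "x $ i = p $ i" if "i \<in> Z p" for i using * that by force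
    then show "x \<in> cube_face (Z p) T" using xc by (auto simp: cube_face_def mem_unit_cube T_def Z_def)
  qed
  moreover have "cube_face (Z p) T \<subseteq> F"
  proof
    fix y assume y: "y \<in> cube_face (Z p) T"
    then have yc: "0 \<le> y $ i" "y $ i \<le> 1" for i by (auto simp: cube_face_def mem_unit_cube)
    have yZ: "y $ i = p $ i" if "i \<in> Z p" for i
      using y that by (auto simp: cube_face_def T_def Z_def)
    show "y \<in> F"
    proof (cases "y = p")
      case False
      \<comment> \<open>The prolongation beyond \<open>p\<close> must keep the free coordinates of \<open>p\<close> inside the unit interval;
        displacements along them are at most 1 in absolute value.\<close>
      define e where "e = Min (insert 1 ((\<lambda>i. min (p $ i) (1 - p $ i)) ` (- Z p)))"
      have "e > 0" unfolding e_def
        using pc by (subst Min_gr_iff) (auto simp: Z_def less_le)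
      have e: "e \<le> p $ i" "e \<le> 1 - p $ i" if "i \<notin> Z p" for i
      proof -
        have "e \<le> min (p $ i) (1 - p $ i)" unfolding e_def by (rule Min_le) (use that in auto)
        then show "e \<le> p $ i" "e \<le> 1 - p $ i" by auto
      qed
      define z where "z = p + e *\<^sub>R (p - y)"
      have "z \<in> cbox 0 1" unfolding mem_unit_cube
      proof
        fix i
        show "0 \<le> z $ i \<and> z $ i \<le> 1"
        proof (cases "i \<in> Z p")
          case True
          then show ?thesis using pc[of i] by (simp add: z_def yZ)
        next
          case False
          have "\<bar>p $ i - y $ i\<bar> \<le> 1" using pc[of i] yc[of i] by auto
          then have "\<bar>e * (p $ i - y $ i)\<bar> \<le> e" using \<open>e > 0\<close> by (simp add: abs_mult)
          then show ?thesis using e[OF False] by (auto simp: z_def)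
        qed
      qed
      moreover have "p \<in> open_segment y z"
        unfolding in_segment
      proof (intro conjI exI[of _ "1 / (1 + e)"])
        show "y \<noteq> z"
        proof
          assume "y = z"
          then have "(1 + e) *\<^sub>R (p - y) = 0" by (simp add: z_def algebra_simps)
          with \<open>e > 0\<close> False show False by simp
        qed
        have "(1 + e) *\<^sub>R p = e *\<^sub>R y + z" by (simp add: z_def algebra_simps)
        then have "(1 / (1 + e)) *\<^sub>R ((1 + e) *\<^sub>R p) = (1 / (1 + e)) *\<^sub>R (e *\<^sub>R y + z)" by simp
        moreover have "1 - 1 / (1 + e) = e / (1 + e)" using \<open>e > 0\<close> by (simp add: field_simps)
        ultimately show "p = (1 - 1 / (1 + e)) *\<^sub>R y + (1 / (1 + e)) *\<^sub>R z"
          using \<open>e > 0\<close> by (simp add: scaleR_add_right)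
      qed (use \<open>e > 0\<close> in auto)
      moreover have "y \<in> cbox 0 1" using y by (simp add: cube_face_def)
      ultimately show ?thesis using F p unfolding face_of_def by blast
    qed (use p in simp)
  qed
  ultimately show ?thesis using that[of T "Z p"] by (auto simp: T_def Z_def)
qed

lemma cube_face_eq_iff:
  assumes "T \<subseteq> S" "T' \<subseteq> S'"
  shows "cube_face S T = cube_face S' T' \<longleftrightarrow> S = S' \<and> T = T'"
  using cube_face_subset_iff[OF assms] cube_face_subset_iff[OF assms(2,1)] assms by blast

definition nonempty_faces :: "(real ^ 'n::finite) set rel" where
  "nonempty_faces = Restr cubical_lattice (Field cubical_lattice - {poset_bot cubical_lattice})"

lemma Field_cubical_lattice:
  "Field (cubical_lattice :: (real ^ 'n::finite) set rel) = {F. F face_of cbox 0 1}"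
  by (auto simp: cubical_lattice_def face_lattice_def Field_def)

lemma poset_bot_cubical_lattice: "poset_bot (cubical_lattice :: (real ^ 'n::finite) set rel) = {}"
  by (rule poset_bot_eqI)
    (auto simp: Field_cubical_lattice, auto simp: cubical_lattice_def face_lattice_def antisym_def)

lemma nonempty_faces_eq:
  "nonempty_faces =
    {(F, G). F face_of cbox 0 1 \<and> F \<noteq> {} \<and> G face_of cbox 0 1 \<and> F \<subseteq> (G :: (real ^ 'n::finite) set)}"
  unfolding nonempty_faces_def poset_bot_cubical_lattice Field_cubical_lattice
  by (auto simp: cubical_lattice_def face_lattice_def)

lemma cube_face_ne: "cube_face S T \<noteq> {}"
  using cube_face_center_mem by blast

text \<open>
  The faces above a given one are obtained by releasing fixed coordinates, so they correspond to the
  subsets of \<open>S\<close>.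
\<close>

lemma nonempty_faces_iff:
  assumes "T \<subseteq> S"
  shows "(cube_face S T, G) \<in> nonempty_faces \<longleftrightarrow> (\<exists>S'\<subseteq>S. G = cube_face S' (T \<inter> S'))"
proof
  assume "(cube_face S T, G) \<in> nonempty_faces"
  then have G: "G face_of cbox 0 1" and le: "cube_face S T \<subseteq> G" by (auto simp: nonempty_faces_eq)
  then have "G \<noteq> {}" using cube_face_ne by blast
  with G obtain S' T' where "T' \<subseteq> S'" "G = cube_face S' T'"
    by (rule face_of_cube_imp_cube_face)
  with le cube_face_subset_iff[OF assms] show "\<exists>S'\<subseteq>S. G = cube_face S' (T \<inter> S')" by blast
next
  assume "\<exists>S'\<subseteq>S. G = cube_face S' (T \<inter> S')"
  then obtain S' where S': "S' \<subseteq> S" and G: "G = cube_face S' (T \<inter> S')" by blast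
  have "cube_face S T \<subseteq> G"
    unfolding G using S' by (subst cube_face_subset_iff[OF assms]) auto
  then show "(cube_face S T, G) \<in> nonempty_faces"
    by (simp add: nonempty_faces_eq cube_face_face_of cube_face_ne G)
qed

lemma Field_nonempty_faces:
  "Field nonempty_faces = (\<lambda>(S, T). cube_face S T) ` (SIGMA S:UNIV. Pow S)"
proof -
  have "Field nonempty_faces = {F. F face_of cbox 0 1 \<and> F \<noteq> {}}"
    by (auto simp: Field_def nonempty_faces_eq)
  also have "\<dots> = (\<lambda>(S, T). cube_face S T) ` (SIGMA S:UNIV. Pow S)"
    by (force simp: cube_face_face_of cube_face_ne elim!: face_of_cube_imp_cube_face)
  finally show ?thesis .
qed

lemma inj_on_cube_face: "inj_on (\<lambda>(S, T). cube_face S T) (SIGMA S:UNIV. Pow S)"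
  by (auto simp: inj_on_def cube_face_eq_iff)

lemma finite_nonempty_faces: "finite nonempty_faces"
proof -
  have "finite (Field nonempty_faces)" unfolding Field_nonempty_faces by simp
  then show ?thesis
    by (intro finite_subset[of nonempty_faces "Field nonempty_faces \<times> Field nonempty_faces"])
      (auto simp: FieldI1 FieldI2)
qed

lemma Partial_order_nonempty_faces: "Partial_order nonempty_faces"
  by (auto simp: order_on_defs nonempty_faces_eq refl_on_def trans_def antisym_def Field_def)

text \<open>
  The coordinates that vary on a face; their number is its dimension.
\<close>

definition free_coords :: "(real ^ 'n::finite) set \<Rightarrow> 'n set" where
  "free_coords F = {i. \<exists>x\<in>F. 0 < x $ i \<and> x $ i < 1}"

lemma free_coords_cube_face: "free_coords (cube_face S T) = - S"
proof -
  have "i \<notin> S" if "x \<in> cube_face S T" "0 < x $ i" "x $ i < 1" for x i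
    using that by (auto simp: cube_face_def of_bool_def split: if_splits)
  moreover have "\<exists>x\<in>cube_face S T. 0 < x $ i \<and> x $ i < 1" if "i \<notin> S" for i
    by (rule bexI[OF _ cube_face_center_mem]) (use that in \<open>simp add: cube_face_center_def\<close>)
  ultimately show ?thesis by (auto simp: free_coords_def)
qed

text \<open>
  A minimal face fixes all coordinates, as fixing the remaining ones at 0 gives a smaller face.
  In a covering, exactly one coordinate is freed: if \<open>i\<close> is one of those, then freeing all the others
  but keeping \<open>i\<close> fixed gives an intermediate face.
\<close>

lemma rank_function_nonempty_faces:
  "rank_function nonempty_faces (\<lambda>F :: (real ^ 'n::finite) set. card (free_coords F))"
  unfolding rank_function_def
proof (intro conjI ballI allI impI)
  fix F :: "(real ^ 'n) set"
  assume "F \<in> Field nonempty_faces" and min: "\<forall>G. (G, F) \<in> nonempty_faces \<longrightarrow> G = F"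
  then obtain S T where T: "T \<subseteq> S" and F: "F = cube_face S T" by (auto simp: Field_nonempty_faces)
  have "(cube_face UNIV T, F) \<in> nonempty_faces" unfolding F
    using T by (subst nonempty_faces_iff) (auto intro!: exI[of _ S] arg_cong2[where f = cube_face])
  with min F T have "S = UNIV" using cube_face_eq_iff[of T UNIV T S] by auto
  then show "card (free_coords F) = 0" by (simp add: F free_coords_cube_face)
next
  fix F G :: "(real ^ 'n) set"
  assume cov: "covers nonempty_faces F G"
  then have FG: "(F, G) \<in> nonempty_faces" "F \<noteq> G" by (auto simp: covers_def)
  from FG(1) have "F \<in> Field nonempty_faces" by (rule FieldI1)
  then obtain S T where T: "T \<subseteq> S" and F: "F = cube_face S T" by (auto simp: Field_nonempty_faces)
  from FG(1) obtain S' where S': "S' \<subseteq> S" "G = cube_face S' (T \<inter> S')"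
    unfolding F nonempty_faces_iff[OF T] by blast
  have "S \<noteq> S'" using FG(2) T F S'(2) by (auto simp: Int_absorb2)
  then obtain i where i: "i \<in> S" "i \<notin> S'" using S'(1) by blast
  let ?H = "cube_face (insert i S') (T \<inter> insert i S')"
  have "(F, ?H) \<in> nonempty_faces"
    unfolding F nonempty_faces_iff[OF T] using i S' by blast
  moreover have "(?H, G) \<in> nonempty_faces"
    by (subst nonempty_faces_iff) (auto simp: S'(2) intro!: exI[of _ S'] arg_cong2[where f = cube_face])
  ultimately have "?H = F \<or> ?H = G" using cov by (auto simp: covers_def)
  then have "insert i S' = S \<or> insert i S' = S'"
    unfolding F S'(2) using T cube_face_eq_iff by (metis inf_le2)
  then have "S = insert i S'" using i by blast
  then have "- S' = insert i (- S)" using i by blast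
  then have "card (- S') = card (- S) + 1" using i(1) by (simp add: card_insert_if)
  then show "card (free_coords G) = card (free_coords F) + 1"
    by (simp add: F S'(2) free_coords_cube_face)
qed

lemma poset_rank_cube_face:
  fixes S T :: "'n::finite set"
  assumes "T \<subseteq> S"
  shows "poset_rank nonempty_faces (cube_face S T) = CARD('n) - card S"
  using poset_rank_eq[OF finite_nonempty_faces Partial_order_nonempty_faces rank_function_nonempty_faces,
      of "cube_face S T"] assms
  by (force simp: Field_nonempty_faces free_coords_cube_face Compl_eq_Diff_UNIV card_Diff_subset)

lemma sum_Field_nonempty_faces:
  fixes g :: "(real ^ 'n::finite) set \<Rightarrow> int"
  shows "(\<Sum>F\<in>Field nonempty_faces. g F) = (\<Sum>S\<in>UNIV. \<Sum>T\<in>Pow S. g (cube_face S T))"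
  unfolding Field_nonempty_faces sum.reindex[OF inj_on_cube_face]
  by (simp add: sum.Sigma split_beta)

lemma sum_above_cube_face:
  fixes g :: "(real ^ 'n::finite) set \<Rightarrow> int"
  assumes "T \<subseteq> S"
  shows "(\<Sum>G | (cube_face S T, G) \<in> nonempty_faces. g G) =
    (\<Sum>S'\<in>Pow S. g (cube_face S' (T \<inter> S')))"
proof -
  have "{G. (cube_face S T, G) \<in> nonempty_faces} = (\<lambda>S'. cube_face S' (T \<inter> S')) ` Pow S"
    by (auto simp: nonempty_faces_iff[OF assms])
  moreover have "inj_on (\<lambda>S'. cube_face S' (T \<inter> S')) (Pow S)"
    by (auto simp: inj_on_def cube_face_eq_iff)
  ultimately show ?thesis by (simp add: sum.reindex)
qed

section \<open>The cubical lattice\<close>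

theorem theorem6p2:
  fixes n :: nat
  assumes "CARD('n::finite) = n"
  shows "poset_mu (Rees (cubical_lattice :: (real ^ 'n) set rel) (chain_poset (n + 1)))
           = (-1) ^ n * int n * int (signed_derangement (n - 1))"
proof -
  let ?P = "nonempty_faces :: (real ^ 'n) set rel"
  let ?\<rho> = "poset_rank ?P"
  define h :: "int \<Rightarrow> nat \<Rightarrow> int" where "h x s = fact s * x ^ s" for x s
  \<comment> \<open>The Moebius value of the interval from \<open>(F, i)\<close> to the top, in terms of the codimension of \<open>F\<close>.\<close>
  define f :: "(real ^ 'n) set \<Rightarrow> int" where "f F = - h (- 1) (n - ?\<rho> F)" for F
  have n: "n > 0" using assms by (metis zero_less_card_finite)
  have le_n: "card S \<le> n" for S :: "'n set" using assms card_mono[of UNIV S] by simp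
  have rank: "?\<rho> (cube_face S T) = n - card S" if "T \<subseteq> S" for S T :: "'n set"
    using poset_rank_cube_face[OF that] assms by simp
  have f: "f (cube_face S T) = - h (- 1) (card S)" if "T \<subseteq> S" for S T :: "'n set"
    using that le_n[of S] by (simp add: f_def rank)
  have "poset_mu (adjoin_bounds (rees_product ?P (chain_poset (n + 1)))) =
    - 1 - (\<Sum>F\<in>Field ?P. int (?\<rho> F + 1) * f F)"
  proof (rule poset_mu_rees_chain[OF finite_nonempty_faces Partial_order_nonempty_faces])
    fix F G assume FG: "(F, G) \<in> ?P"
    then have "F \<in> Field ?P" by (rule FieldI1)
    then obtain S T where T: "T \<subseteq> S" "F = cube_face S T" by (auto simp: Field_nonempty_faces)
    with FG obtain S' where "S' \<subseteq> S" "G = cube_face S' (T \<inter> S')"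
      by (auto simp: nonempty_faces_iff)
    then show "?\<rho> F \<le> ?\<rho> G" using T card_mono[of S S'] by (simp add: rank)
  next
    fix F assume "F \<in> Field ?P"
    then obtain S T where T: "T \<subseteq> S" "F = cube_face S T" by (auto simp: Field_nonempty_faces)
    then show "?\<rho> F < n + 1" by (simp add: rank)
    let ?k = "card S"
    have "(\<Sum>G | (F, G) \<in> ?P. int (?\<rho> G - ?\<rho> F + 1) * f G) =
        (\<Sum>A\<in>Pow S. - (int (?k - card A + 1) * h (- 1) (card A)))"
      unfolding T(2) sum_above_cube_face[OF T(1)]
    proof (rule sum.cong[OF refl])
      fix A assume "A \<in> Pow S"
      then have "card A \<le> ?k" by (auto intro: card_mono)
      then show "int (?\<rho> (cube_face A (T \<inter> A)) - ?\<rho> (cube_face S T) + 1) *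
          f (cube_face A (T \<inter> A)) = - (int (?k - card A + 1) * h (- 1) (card A))"
        using T(1) le_n[of S] by (simp add: rank f)
    qed
    also have "\<dots> = - (\<Sum>s\<le>?k. int (?k choose s) * (int (?k - s + 1) * h (- 1) s))"
      by (simp only: sum_negf sum_Pow_card[of S "\<lambda>s. int (?k - s + 1) * h (- 1) s", OF finite])
    also have "\<dots> = - 1"
      unfolding h_def using sum_choose_fact_identity[of ?k "- 1"] by (cases "?k = 0") auto
    finally show "(\<Sum>G | (F, G) \<in> ?P. int (?\<rho> G - ?\<rho> F + 1) * f G) = - 1" .
  qed
  also have "(\<Sum>F\<in>Field ?P. int (?\<rho> F + 1) * f F) =
      (\<Sum>S\<in>UNIV. - (int (n - card (S :: 'n set) + 1) * h (- 2) (card S)))"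
    unfolding sum_Field_nonempty_faces
  proof (rule sum.cong[OF refl])
    fix S :: "'n set"
    have "(\<Sum>T\<in>Pow S. int (?\<rho> (cube_face S T) + 1) * f (cube_face S T)) =
        (\<Sum>T\<in>Pow S. - (int (n - card S + 1) * h (- 1) (card S)))"
      by (rule sum.cong) (auto simp: rank f)
    also have "\<dots> = - (int (n - card S + 1) * (2 ^ card S * h (- 1) (card S)))"
      by (simp add: card_Pow)
    also have "2 ^ card S * h (- 1) (card S) = h (- 2) (card S)"
      by (simp add: h_def power_mult_distrib[symmetric] mult.left_commute)
    finally show "(\<Sum>T\<in>Pow S. int (?\<rho> (cube_face S T) + 1) * f (cube_face S T)) =
      - (int (n - card S + 1) * h (- 2) (card S))" .
  qed
  also have "\<dots> = - (\<Sum>s\<le>n. int (n choose s) * (int (n - s + 1) * h (- 2) s))"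
    using sum_Pow_card[of "UNIV :: 'n set" "\<lambda>s. int (n - s + 1) * h (- 2) s"] assms
    by (simp only: sum_negf Pow_UNIV finite)
  also have "\<dots> = int n * (\<Sum>s<n. int (n - 1 choose s) * h (- 2) s) - 1"
    unfolding h_def by (subst sum_choose_fact_identity[OF n]) simp
  also have "{..<n} = {..n - 1}" using n by auto
  also have "(\<Sum>s\<le>n - 1. int (n - 1 choose s) * h (- 2) s) =
      (- 1) ^ (n - 1) * int (signed_derangement (n - 1))"
    unfolding h_def signed_derangement_eq by (simp flip: mult.assoc power_mult_distrib)
  finally show ?thesis
    unfolding Rees_def nonempty_faces_def[symmetric]
    using n by (cases n) auto
qed

end
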